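(* For every $n,r$ with $r\le n^2$, there exists an $n$-vertex directed graph $G$ and a set $\mathcal{P}$ of $r$ vertex pairs such that any 2-fault-tolerant reachability subgraph of $G$ for $\mathcal{P}$ has $\Omega(n\sqrt{|\mathcal{P}|})$ edges.
   Context: A subgraph $H$ of $G=(V,E)$ is a $k$-fault-tolerant reachability subgraph of $G$ for $\mathcal{P}\subseteq V\times V$ if for every pair $(s,t)\in\mathcal{P}$ and every set $F\subseteq E$ of at most $k$ edges, $t$ is reachable from $s$ in $G\setminus F$ if and only if $t$ is reachable from $s$ in $H\setminus F$.
   Formalization: The case n = r = 1 is excluded: for a one-vertex graph the subgraph without edges is always fault-tolerant, so no positive constant in the Ω bound works there; all other n, r with r ≤ n² are covered with one absolute constant. *)

theory Defs
  imports Complex_Main "Graph_Theory.Digraph_Component"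
begin

definition del_arcs :: "('a, 'b) pre_digraph \<Rightarrow> 'b set \<Rightarrow> ('a, 'b) pre_digraph" where
  "del_arcs G F = G\<lparr>arcs := arcs G - F\<rparr>"

(* F ranges over sets of arcs of G, so it may contain arcs that are absent from H.
   For a finite digraph G, F is finite and "card F \<le> k" has its intended meaning. *)
definition fault_tolerant_reachability_subgraph ::
    "nat \<Rightarrow> ('a, 'b) pre_digraph \<Rightarrow> ('a \<times> 'a) set \<Rightarrow> ('a, 'b) pre_digraph \<Rightarrow> bool" where
  "fault_tolerant_reachability_subgraph k G P H \<longleftrightarrow>
     subgraph H G \<and>
     (\<forall>(s, t) \<in> P. \<forall>F. F \<subseteq> arcs G \<and> card F \<le> k \<longrightarrow>
        (reachable (del_arcs G F) s t \<longleftrightarrow> reachable (del_arcs H F) s t))"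

end

theory Submission
  imports Defs "HOL-Library.Discrete_Functions"
begin

text \<open>
  Take \<open>q\<close> source paths and \<open>q\<close> sink paths on \<open>L\<close> vertices each, and join the \<open>l\<close>-th vertex of
  every source path to the \<open>l\<close>-th vertex of every sink path. Let \<open>s\<close> be the start of source path
  \<open>i\<close> and \<open>t\<close> the end of sink path \<open>k\<close>. If the arc leaving position \<open>l\<close> on path \<open>i\<close> and the arc
  entering position \<open>l\<close> on path \<open>k\<close> fail, then \<open>s\<close> reaches only the positions \<open>\<le> l\<close> of path \<open>i\<close>,
  and only the positions \<open>\<ge> l\<close> of path \<open>k\<close> reach \<open>t\<close>, so the cross arc at position \<open>l\<close> is the
  only connection left. Hence the \<open>q\<^sup>2\<close> pairs \<open>(s, t)\<close> force all \<open>q\<^sup>2 L\<close> cross arcs, and we choose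
  \<open>q\<close> of order \<open>\<surd>r\<close> and \<open>L\<close> of order \<open>n / q\<close>.
\<close>

text \<open>An arc-closed set that contains \<open>s\<close> but not \<open>t\<close> certifies that
  \<open>t\<close> is unreachable; the separation argument below uses it this way.\<close>

lemma reachable_closed:
  assumes "reachable G s t" "s \<in> R"
    and "\<And>e. e \<in> arcs G \<Longrightarrow> tail G e \<in> R \<Longrightarrow> head G e \<in> R"
  shows "t \<in> R"
  using assms(1) unfolding reachable_def
  by (induction rule: rtrancl_on_induct) (use assms(2,3) in \<open>auto simp: arcs_ends_conv\<close>)

lemma (in wf_digraph) reachable_nat_path:
  fixes f :: "nat \<Rightarrow> 'a"
  assumes "a \<le> b" "f a \<in> verts G"
    and "\<And>x. a \<le> x \<Longrightarrow> x < b \<Longrightarrow> f x \<rightarrow> f (Suc x)"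
  shows "f a \<rightarrow>\<^sup>* f b"
  using assms
proof (induction b rule: dec_induct)
  case base
  then show ?case by auto
next
  case (step m)
  then have "f a \<rightarrow>\<^sup>* f m" "f m \<rightarrow> f (Suc m)" by auto
  then show ?case by (rule reachable_adj_trans)
qed

text \<open>
  Vertex \<open>j * L + l\<close> is position \<open>l\<close> on path \<open>j\<close>; the paths \<open>j < q\<close> are the source paths and the
  paths \<open>q \<le> j < 2 * q\<close> are the sink paths.
\<close>

definition grid_arcs :: "nat \<Rightarrow> nat \<Rightarrow> (nat \<times> nat) set" where
  "grid_arcs q L = {(u, v). u < 2 * q * L \<and> v < 2 * q * L \<and>
     (v = Suc u \<and> u div L = v div L \<or> u div L < q \<and> q \<le> v div L \<and> u mod L = v mod L)}"

text \<open>The vertices from \<open>2 * q * L\<close> on are isolated and pad the graph to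
  \<open>n\<close> vertices.\<close>

definition grid_graph :: "nat \<Rightarrow> nat \<Rightarrow> nat \<Rightarrow> (nat, nat \<times> nat) pre_digraph" where
  "grid_graph n q L = \<lparr>verts = {..<n}, arcs = grid_arcs q L, tail = fst, head = snd\<rparr>"

definition grid_pairs :: "nat \<Rightarrow> nat \<Rightarrow> (nat \<times> nat) set" where
  "grid_pairs q L = (\<lambda>(i, k). (i * L, k * L + (L - 1))) ` ({..<q} \<times> {q..<2 * q})"

definition cross_arcs :: "nat \<Rightarrow> nat \<Rightarrow> (nat \<times> nat) set" where
  "cross_arcs q L = (\<lambda>(i, k, l). (i * L + l, k * L + l)) ` ({..<q} \<times> {q..<2 * q} \<times> {..<L})"

lemma grid_vertex_less:
  fixes j l L m :: nat
  assumes "j < m" "l < L"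
  shows "j * L + l < m * L"
proof -
  have "j * L + l < Suc j * L" using assms by simp
  also have "\<dots> \<le> m * L" using assms by (intro mult_le_mono1) simp
  finally show ?thesis .
qed

lemma finite_grid_arcs: "finite (grid_arcs q L)"
  by (rule finite_subset[of _ "{..<2 * q * L} \<times> {..<2 * q * L}"]) (auto simp: grid_arcs_def)

lemma digraph_grid_graph:
  assumes "2 * q * L \<le> n"
  shows "digraph (grid_graph n q L)"
proof -
  have "finite (grid_arcs q L)" by (rule finite_grid_arcs)
  then show ?thesis
    using assms
    by unfold_locales (auto simp: grid_graph_def grid_arcs_def arc_to_ends_def)
qed

lemma card_cross_arcs: "card (cross_arcs q L) = q * q * L"
proof -
  have "inj_on (\<lambda>(i, k, l). (i * L + l, k * L + l)) ({..<q} \<times> {q..<2 * q} \<times> {..<L})"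
  proof (rule inj_on_inverseI)
    fix x assume "x \<in> {..<q} \<times> {q..<2 * q} \<times> {..<L}"
    then show "(\<lambda>(u, v). (u div L, v div L, u mod L)) ((\<lambda>(i, k, l). (i * L + l, k * L + l)) x) = x"
      by auto
  qed
  then show ?thesis
    unfolding cross_arcs_def by (subst card_image) (auto simp: card_cartesian_product)
qed

lemma wf_digraph_del_arcs: "wf_digraph G \<Longrightarrow> wf_digraph (del_arcs G F)"
  by (auto simp: wf_digraph_def del_arcs_def)

lemma cross_arc_necessary:
  assumes n: "2 * q * L \<le> n" and P: "grid_pairs q L \<subseteq> P"
    and ft: "fault_tolerant_reachability_subgraph 2 (grid_graph n q L) P H"
    and i: "i < q" and k: "q \<le> k" "k < 2 * q" and l: "l < L"
  shows "(i * L + l, k * L + l) \<in> arcs H"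
proof (rule ccontr)
  assume missing: "(i * L + l, k * L + l) \<notin> arcs H"
  define G where "G = grid_graph n q L"
  define F where "F = {(i * L + l, Suc (i * L + l)), (k * L + l - 1, k * L + l)} \<inter>
    {(u, v) \<in> arcs G. u div L = v div L}"
    \<comment> \<open>If \<open>L = 1\<close>, the pair \<open>(i * L + l, Suc (i * L + l))\<close> can be the cross arc itself; requiring
      both ends to lie on the same path excludes this.\<close>
  define D where "D = del_arcs G F"
  define s where "s = i * L"
  define t where "t = k * L + (L - 1)"
  have G_simps: "verts G = {..<n}" "arcs G = grid_arcs q L" "tail G = fst" "head G = snd"
    by (simp_all add: G_def grid_graph_def)
  have D_simps: "verts D = {..<n}" "arcs D = grid_arcs q L - F" "tail D = fst" "head D = snd"
    by (simp_all add: D_def del_arcs_def G_simps)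
  have H: "subgraph H G" using ft by (simp add: fault_tolerant_reachability_subgraph_def G_def)
  have H_simps: "arcs H \<subseteq> grid_arcs q L" "tail H = fst" "head H = snd"
    using H by (auto simp: subgraph_def compatible_def G_simps)
  have adjD: "u \<rightarrow>\<^bsub>D\<^esub> v" if "(u, v) \<in> grid_arcs q L - F" for u v
    using that by (force simp: arcs_ends_conv D_simps)
  have bound: "j * L + m < 2 * q * L" if "j < 2 * q" "m < L" for j m
    using that by (rule grid_vertex_less)
  have "wf_digraph G"
    using digraph_grid_graph[OF n] by (simp add: G_def digraph_def fin_digraph_def)
  then interpret D: wf_digraph D
    unfolding D_def by (rule wf_digraph_del_arcs)
  have ikne: "i \<noteq> k" using i k by simp
  have div_eq: "m < L \<Longrightarrow> (j * L + m) div L = j" for j m by simp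
  have vert_eq: "j * L + m = j' * L + m' \<longleftrightarrow> j = j' \<and> m = m'" if "m < L" "m' < L" for j j' m m'
  proof
    assume eq: "j * L + m = j' * L + m'"
    have "j = j'" using arg_cong[OF eq, of "\<lambda>x. x div L"] that by simp
    with eq show "j = j' \<and> m = m'" by simp
  qed simp
  have path_arc: "(j * L + m, Suc (j * L + m)) \<in> grid_arcs q L" if "j < 2 * q" "Suc m < L" for j m
    using bound[of j m] bound[of j "Suc m"] that
      div_eq[of m j] div_eq[of "Suc m" j]
    by (simp add: grid_arcs_def)
  \<comment> \<open>A walk from \<open>s\<close> to \<open>t\<close> survives in \<open>D\<close>:
    along path \<open>i\<close> to position \<open>l\<close>, over the cross arc, then along path
    \<open>k\<close> to its end. Its arcs on path \<open>i\<close> start before position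
    \<open>l\<close> and those on path \<open>k\<close> end after it, so none of them is in
    \<open>F\<close>.\<close>
  have "(\<lambda>m. i * L + m) 0 \<rightarrow>\<^sup>*\<^bsub>D\<^esub> (\<lambda>m. i * L + m) l"
  proof (rule D.reachable_nat_path[where f = "\<lambda>m. i * L + m" and a = 0 and b = l])
    show "i * L + 0 \<in> verts D" using order.strict_trans2[OF bound[of i 0] n] i l by (simp add: D_simps)
    fix x assume x: "x < l"
    have "Suc (i * L + x) \<noteq> k * L + l" using vert_eq[of "Suc x" l i k] x l ikne by simp
    then have "(i * L + x, Suc (i * L + x)) \<notin> F" using x by (auto simp: F_def)
    then show "(i * L + x) \<rightarrow>\<^bsub>D\<^esub> (i * L + Suc x)"
      using path_arc[of i x] x l i by (auto intro!: adjD)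
  qed simp
  then have 1: "s \<rightarrow>\<^sup>*\<^bsub>D\<^esub> (i * L + l)" by (simp add: s_def)
  have "(i * L + l, k * L + l) \<notin> F" using ikne l by (auto simp: F_def)
  moreover have "(i * L + l, k * L + l) \<in> grid_arcs q L"
    using bound[of i l] bound[of k l] i k l by (simp add: grid_arcs_def)
  ultimately have 2: "(i * L + l) \<rightarrow>\<^bsub>D\<^esub> (k * L + l)" by (auto intro!: adjD)
  have "(\<lambda>m. k * L + m) l \<rightarrow>\<^sup>*\<^bsub>D\<^esub> (\<lambda>m. k * L + m) (L - 1)"
  proof (rule D.reachable_nat_path[where f = "\<lambda>m. k * L + m" and a = l and b = "L - 1"])
    show "k * L + l \<in> verts D" using bound[of k l] k l n by (simp add: D_simps)
    fix x assume x: "l \<le> x" "x < L - 1"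
    have "k * L + x \<noteq> i * L + l" using vert_eq[of x l k i] x l ikne by simp
    then have "(k * L + x, Suc (k * L + x)) \<notin> F" using x by (auto simp: F_def)
    then show "(k * L + x) \<rightarrow>\<^bsub>D\<^esub> (k * L + Suc x)"
      using path_arc[of k x] x l k by (auto intro!: adjD)
  qed (use l in simp)
  then have 3: "(k * L + l) \<rightarrow>\<^sup>*\<^bsub>D\<^esub> t" by (simp add: t_def)
  have "s \<rightarrow>\<^sup>*\<^bsub>D\<^esub> t"
    using 1 2 3 D.reachable_adj_trans D.reachable_trans by blast
  moreover have "(s, t) \<in> P"
    using P i k by (force simp: grid_pairs_def s_def t_def)
  moreover have "card F \<le> 2"
  proof -
    \<comment> \<open>No path arc enters position \<open>0\<close> or leaves position
      \<open>L - 1\<close>, so the intersection in \<open>F\<close> may drop a pair.\<close>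
    have "card F \<le> card {(i * L + l, Suc (i * L + l)), (k * L + l - 1, k * L + l)}"
      unfolding F_def by (rule card_mono) auto
    also have "\<dots> \<le> 2" by (simp add: card_insert_if)
    finally show ?thesis .
  qed
  moreover have "F \<subseteq> arcs G" by (auto simp: F_def)
  ultimately have reach: "s \<rightarrow>\<^sup>*\<^bsub>del_arcs H F\<^esub> t"
    using ft unfolding fault_tolerant_reachability_subgraph_def D_def G_def[symmetric] by blast

  \<comment> \<open>\<open>R\<close> over-approximates what \<open>s\<close> reaches in
    \<open>H\<close> after the failures. The other sink paths lie in it entirely, since no arc
    leaves a sink path; \<open>t\<close> lies outside because its position \<open>L - 1\<close> is
    at least \<open>l\<close>.\<close>
  define R where "R = {u. u div L = i \<and> u mod L \<le> l \<or>
    q \<le> u div L \<and> (u div L = k \<longrightarrow> u mod L < l)}"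
  have "t \<in> R"
  proof (rule reachable_closed[OF reach])
    show "s \<in> R" using l by (simp add: R_def s_def)
    fix e assume e: "e \<in> arcs (del_arcs H F)" "tail (del_arcs H F) e \<in> R"
    obtain u v where uv: "e = (u, v)" by (cases e)
    have uv_arc: "(u, v) \<in> arcs H" "(u, v) \<in> grid_arcs q L" "(u, v) \<notin> F" and u: "u \<in> R"
      using e H_simps by (auto simp: uv del_arcs_def)
    have u_eq: "u = u div L * L + u mod L" and v_eq: "v = v div L * L + v mod L" by simp_all
    from uv_arc(2) consider "v = Suc u" "u div L = v div L"
      | "u div L < q" "q \<le> v div L" "u mod L = v mod L"
      by (auto simp: grid_arcs_def)
    then have "v \<in> R"
    proof cases
      case 1
      then have mod: "v mod L = Suc (u mod L)" using u_eq v_eq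
        by (metis add_Suc_right add_left_cancel)
      \<comment> \<open>Along a path, \<open>R\<close> could be left only from position
        \<open>l\<close> of path \<open>i\<close> or into position \<open>l\<close> of path
        \<open>k\<close>, and both of these arcs are in \<open>F\<close>.\<close>
      have "u mod L \<noteq> l" if "u div L = i"
        using uv_arc(2,3) that u_eq 1 by (auto simp: F_def G_simps)
      moreover have "Suc (u mod L) \<noteq> l" if "u div L = k"
        using uv_arc(2,3) that u_eq v_eq 1 mod by (auto simp: F_def G_simps)
      ultimately show ?thesis using u 1 mod i k by (auto simp: R_def)
    next
      case 2
      then have ui: "u div L = i" "u mod L \<le> l" using u by (auto simp: R_def)
      \<comment> \<open>Among the cross arcs that start in \<open>R\<close>, only the one at
        position \<open>l\<close> from path \<open>i\<close> to path \<open>k\<close> would leave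
        \<open>R\<close>, and \<open>H\<close> lacks it.\<close>
      have "u mod L \<noteq> l" if "v div L = k"
        using uv_arc(1) missing u_eq v_eq ui 2 that by metis
      then show ?thesis using ui 2 by (auto simp: R_def)
    qed
    then show "head (del_arcs H F) e \<in> R" by (simp add: uv del_arcs_def H_simps)
  qed
  moreover have "t div L = k" "t mod L = L - 1"
    unfolding t_def using l by (simp_all only: div_mult_self3 mod_mult_self3) simp_all
  ultimately show False using i k l by (auto simp: R_def)
qed

lemma card_arcs_lower_bound:
  assumes "2 * q * L \<le> n" "grid_pairs q L \<subseteq> P"
    and ft: "fault_tolerant_reachability_subgraph 2 (grid_graph n q L) P H"
  shows "q * q * L \<le> card (arcs H)"
proof -
  have "arcs H \<subseteq> grid_arcs q L"
    using ft by (auto simp: fault_tolerant_reachability_subgraph_def subgraph_def grid_graph_def)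
  then have "finite (arcs H)" by (rule finite_subset) (rule finite_grid_arcs)
  moreover have "cross_arcs q L \<subseteq> arcs H"
    using cross_arc_necessary[OF assms] by (auto simp: cross_arcs_def)
  ultimately show ?thesis
    unfolding card_cross_arcs[symmetric] by (rule card_mono)
qed

text \<open>Extra pairs only strengthen the demand on \<open>H\<close>, so padding the grid pairs to
  size \<open>r\<close> preserves the lower bound on arcs.\<close>

lemma grid_pairs_extend:
  assumes "q\<^sup>2 \<le> r" "r \<le> n\<^sup>2" "2 * q * L \<le> n" "0 < L"
  obtains P where "grid_pairs q L \<subseteq> P" "P \<subseteq> {..<n} \<times> {..<n}" "card P = r"
proof -
  have "card (grid_pairs q L) \<le> q\<^sup>2"
    unfolding grid_pairs_def
    by (rule order_trans[OF card_image_le]) (auto simp: power2_eq_square)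
  then have "card (grid_pairs q L) \<le> r" using assms(1) by simp
  moreover have "grid_pairs q L \<subseteq> {..<n} \<times> {..<n}"
  proof -
    have "i * L < n" "k * L + (L - 1) < n" if "i < q" "k < 2 * q" for i k
      using order.strict_trans2[OF grid_vertex_less[of i "2 * q" 0 L] assms(3)]
        order.strict_trans2[OF grid_vertex_less[of k "2 * q" "L - 1" L] assms(3)] that assms(4)
      by auto
    then show ?thesis by (auto simp: grid_pairs_def)
  qed
  moreover have "r \<le> card ({..<n} \<times> {..<n})"
    using assms(2) by (simp add: power2_eq_square)
  ultimately show ?thesis
    using exists_subset_between[of "grid_pairs q L" r "{..<n} \<times> {..<n}"] that by auto
qed

lemma grid_parameters:
  fixes n r :: nat
  assumes "r \<le> n\<^sup>2" "0 < r" "2 \<le> n"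
  obtains q L :: nat where "q\<^sup>2 \<le> r" "2 * q * L \<le> n" "0 < L" "real n * sqrt (real r) \<le> 24 * real (q * q * L)"
proof -
  define s where "s = floor_sqrt r"
  \<comment> \<open>The cap \<open>n div 2\<close> leaves room for \<open>2 * q\<close> paths with
    at least one vertex each; \<open>L\<close> is then the largest length that fits.\<close>
  define q where "q = min s (n div 2)"
  define L where "L = n div (2 * q)"
  have s: "0 < s" "s \<le> n" "s\<^sup>2 \<le> r"
    using assms mono_floor_sqrt'[of r "n\<^sup>2"] by (auto simp: s_def)
  \<comment> \<open>If the cap applies, then \<open>s \<le> n \<le> 3 * (n div 2)\<close>, the last
    step by \<open>2 \<le> n\<close>.\<close>
  have q: "0 < q" "2 * q \<le> n" "q \<le> s" "s \<le> 3 * q"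
    using s assms(3) by (auto simp: q_def min_def)
  have qr: "q\<^sup>2 \<le> r" using q(3) s(3) by (meson le_trans power2_nat_le_eq_le)
  have qL: "2 * q * L \<le> n" by (simp add: L_def)
  have L: "0 < L" using q by (simp add: L_def div_greater_zero_iff)
  have "n < 2 * q * Suc L"
    using dividend_less_times_div[of "2 * q" n] q(1) by (simp add: L_def)
  also have "\<dots> \<le> 2 * q * (2 * L)" using L by (intro mult_le_mono2) simp
  finally have n: "n \<le> 4 * q * L" by simp
  have "r \<le> (Suc s)\<^sup>2"
    using Suc_floor_sqrt_power2_gt[of r] by (simp add: s_def)
  then have "real r \<le> (real (Suc s))\<^sup>2"
    by (metis of_nat_le_iff of_nat_power)
  then have "sqrt r \<le> Suc s"
    by (intro real_le_lsqrt) simp_all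
  also have "Suc s \<le> 6 * q" using s(1) q(4) by simp
  \<comment> \<open>The constant is \<open>24 = 4 * 6\<close>: rounding \<open>L\<close> gives the
    factor 4, and rounding the root and capping \<open>q\<close> give the factor 6.\<close>
  finally have "n * sqrt r \<le> real (4 * q * L) * real (6 * q)"
    using n by (intro mult_mono) (simp_all del: of_nat_mult)
  then have "real n * sqrt (real r) \<le> 24 * real (q * q * L)" by (simp add: algebra_simps)
  with qr qL L show ?thesis by (rule that)
qed

theorem theorem1p6:
  shows "\<exists>c::real. c > 0 \<and>
    (\<forall>n r :: nat. r \<le> n\<^sup>2 \<and> (n, r) \<noteq> (1, 1) \<longrightarrow>
      (\<exists>(G :: (nat, nat \<times> nat) pre_digraph) (P :: (nat \<times> nat) set).
         digraph G \<and> card (verts G) = n \<and>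
         P \<subseteq> verts G \<times> verts G \<and> card P = r \<and>
         (\<forall>H. fault_tolerant_reachability_subgraph 2 G P H \<longrightarrow>
            real (card (arcs H)) \<ge> c * real n * sqrt (real (card P)))))"
proof (intro exI[of _ "1 / 24"] conjI allI impI)
  fix n r :: nat
  assume nr: "r \<le> n\<^sup>2 \<and> (n, r) \<noteq> (1, 1)"
  show "\<exists>(G :: (nat, nat \<times> nat) pre_digraph) P.
         digraph G \<and> card (verts G) = n \<and>
         P \<subseteq> verts G \<times> verts G \<and> card P = r \<and>
         (\<forall>H. fault_tolerant_reachability_subgraph 2 G P H \<longrightarrow>
            real (card (arcs H)) \<ge> 1 / 24 * real n * sqrt (real (card P)))"
  proof (cases "r = 0")
    case True
    then show ?thesis
      using digraph_grid_graph[of 0 0 n]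
      by (intro exI[of _ "grid_graph n 0 0"] exI[of _ "{}"]) (simp add: grid_graph_def)
  next
    case False
    \<comment> \<open>The excluded case \<open>(1, 1)\<close> is a true exception: a loop-free graph
      on one vertex has no arcs, while the bound would be positive.\<close>
    then have "2 \<le> n" using nr by (cases "n = 0"; cases "n = 1") auto
    then obtain q L where q: "q\<^sup>2 \<le> r" and L: "2 * q * L \<le> n" "0 < L"
      and bound: "real n * sqrt (real r) \<le> 24 * real (q * q * L)"
      using nr False grid_parameters[of r n] by auto
    obtain P where P: "grid_pairs q L \<subseteq> P" "P \<subseteq> {..<n} \<times> {..<n}" "card P = r"
      using q nr L by (blast intro: grid_pairs_extend)
    have "1 / 24 * real n * sqrt (real (card P)) \<le> real (card (arcs H))"
      if "fault_tolerant_reachability_subgraph 2 (grid_graph n q L) P H" for H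
    proof -
      have "real (q * q * L) \<le> real (card (arcs H))"
        using card_arcs_lower_bound[OF L(1) P(1) that] by (simp only: of_nat_le_iff)
      then show ?thesis using bound P(3) by simp
    qed
    then show ?thesis
      using P digraph_grid_graph[OF L(1)]
      by (intro exI[of _ "grid_graph n q L"] exI[of _ P]) (simp add: grid_graph_def)
  qed
qed simp

end
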